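(* For every block configuration $\mathcal{B}$ with $\operatorname{rank}(\mathcal{B})=2$ we have $$\mathrm{CTP}(\mathcal{B})=\{x\in\mathrm{TP}(\mathcal{B}) : x\text{ satisfies all LOS inequalities for }\mathrm{CTP}(\mathcal{B})\}.$$
   Context: $\mathbb{F}_2$ is the field with two elements. A block configuration in $\mathbb{F}_2^d$ ($d\ge1$) is a sequence $\mathcal{B}=(\mathcal{B}(1),\dots,\mathcal{B}(n))$ with $n\ge2$ of non-empty subsets (blocks) $\mathcal{B}(i)\subseteq\mathbb{F}_2^d$; $n$ is its length. Its rank is the dimension of the linear span of $\mathcal{B}(1)\cup\dots\cup\mathcal{B}(n)$. A transversal of $\mathcal{B}$ is a sequence $\xi=(\xi(1),\dots,\xi(n))$ with $\xi(i)\in\mathcal{B}(i)$; it is cyclic if $\sum_{i=1}^n\xi(i)=0$ in $\mathbb{F}_2^d$. The incidence vector of $\xi$ is $x=(x^1,\dots,x^n)$, $x^i\in\{0,1\}^{\mathcal{B}(i)}$, with $x^i_\omega=1$ iff $\xi(i)=\omega$. $\mathrm{TP}(\mathcal{B})$ and $\mathrm{CTP}(\mathcal{B})$ are the convex hulls, in $\mathbb{R}^{\mathcal{B}}:=\mathbb{R}^{\mathcal{B}(1)}\times\cdots\times\mathbb{R}^{\mathcal{B}(n)}$, of the incidence vectors of all transversals and of all cyclic transversals of $\mathcal{B}$, respectively. The lifted odd-set (LOS) inequalities for $\mathrm{CTP}(\mathcal{B})$ are the inequalities $$\sum_{i\in I}\sum_{\omega\in\mathcal{B}(i):\,\eta^T\omega=0}x^i_\omega+\sum_{i\in[n]\setminus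 I}\sum_{\omega\in\mathcal{B}(i):\,\eta^T\omega=1}x^i_\omega\ge1$$ for all $\eta\in\mathbb{F}_2^d\setminus\{0\}$ and all $I\subseteq[n]$ of odd cardinality, where $\eta^T\omega$ is computed in $\mathbb{F}_2$. *)

theory Defs
  imports "HOL-Analysis.Analysis" "HOL-Library.Z2"
begin

text \<open>
  The vector space of dimension \<open>d\<close> over the field with two elements is \<^typ>\<open>bit ^ 'd\<close> with
  \<open>d = CARD('d)\<close>. The positions \<open>1, \<dots>, n\<close> of a block configuration are the elements of
  a finite type \<open>'n\<close> with \<open>n = CARD('n)\<close>; their order plays no role.
\<close>

instance bit :: finite
proof
  have "(UNIV :: bit set) \<subseteq> {0, 1}"
    by (auto intro: bit_not_one_iff [THEN iffD1])
  then show "finite (UNIV :: bit set)"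
    by (rule finite_subset) simp
qed

definition block_configuration :: "('n::finite \<Rightarrow> (bit ^ 'd::finite) set) \<Rightarrow> bool" where
  "block_configuration B \<longleftrightarrow> 2 \<le> CARD('n) \<and> (\<forall>i. B i \<noteq> {})"

definition block_rank :: "('n::finite \<Rightarrow> (bit ^ 'd::finite) set) \<Rightarrow> nat" where
  "block_rank B = vec.dim (vec.span (\<Union>i. B i))"

definition transversal ::
    "('n::finite \<Rightarrow> (bit ^ 'd::finite) set) \<Rightarrow> ('n \<Rightarrow> bit ^ 'd) \<Rightarrow> bool" where
  "transversal B \<xi> \<longleftrightarrow> (\<forall>i. \<xi> i \<in> B i)"

definition cyclic_transversal ::
    "('n::finite \<Rightarrow> (bit ^ 'd::finite) set) \<Rightarrow> ('n \<Rightarrow> bit ^ 'd) \<Rightarrow> bool" where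
  "cyclic_transversal B \<xi> \<longleftrightarrow> transversal B \<xi> \<and> (\<Sum>i\<in>UNIV. \<xi> i) = 0"

text \<open>
  The ambient space of the polytopes, the product of the spaces of real functions on the blocks
  \<open>B i\<close>, is embedded into \<^typ>\<open>real ^ (bit ^ 'd) ^ 'n\<close> as the subspace of all \<open>x\<close> with
  \<open>x $ i $ \<omega> = 0\<close> whenever \<open>\<omega> \<notin> B i\<close>. Incidence vectors of transversals, and hence their convex
  hulls, lie in this subspace.
\<close>

definition incidence_vector ::
    "('n::finite \<Rightarrow> bit ^ 'd::finite) \<Rightarrow> real ^ (bit ^ 'd) ^ 'n" where
  "incidence_vector \<xi> = (\<chi> i \<omega>. if \<xi> i = \<omega> then 1 else 0)"

definition TP :: "('n::finite \<Rightarrow> (bit ^ 'd::finite) set) \<Rightarrow> (real ^ (bit ^ 'd) ^ 'n) set" where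
  "TP B = convex hull {incidence_vector \<xi> | \<xi>. transversal B \<xi>}"

definition CTP :: "('n::finite \<Rightarrow> (bit ^ 'd::finite) set) \<Rightarrow> (real ^ (bit ^ 'd) ^ 'n) set" where
  "CTP B = convex hull {incidence_vector \<xi> | \<xi>. cyclic_transversal B \<xi>}"

definition LOS_inequality ::
    "('n::finite \<Rightarrow> (bit ^ 'd::finite) set) \<Rightarrow> bit ^ 'd \<Rightarrow> 'n set \<Rightarrow> real ^ (bit ^ 'd) ^ 'n \<Rightarrow> bool"
  where
  "LOS_inequality B \<eta> I x \<longleftrightarrow>
     (\<Sum>i\<in>I. \<Sum>\<omega> | \<omega> \<in> B i \<and> scalar_product \<eta> \<omega> = 0. x $ i $ \<omega>) +
     (\<Sum>i\<in>UNIV - I. \<Sum>\<omega> | \<omega> \<in> B i \<and> scalar_product \<eta> \<omega> = 1. x $ i $ \<omega>) \<ge> 1"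

end

theory Submission
  imports Defs
begin

text \<open>
  Cyclic transversals satisfy the LOS inequalities because \<open>\<eta>\<close> takes the value \<open>1\<close> on an even number
  of their entries, a number that cannot match an odd set \<open>I\<close> exactly. The content is the converse.

  A span of dimension two carries exactly three non-zero functionals, and each of its non-zero vectors
  is sent to \<open>1\<close> by exactly two of them. Read \<open>x\<close> as a family of probability distributions, one row
  per position \<open>i\<close>; each of the three functionals \<open>\<eta>\<close> gives a column \<open>y\<^sub>i = Pr (\<eta> \<xi>(i) = 1)\<close>, and
  the LOS inequalities say that the \<open>\<ell>\<^sub>1\<close>-distance of this column from every odd \<open>0/1\<close>-vector is at
  least \<open>1\<close>. The matrices that satisfy them for the three functionals form a polytope. By the
  theorem of Krein, Milman and Minkowski it is enough that its extreme points are incidence vectors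
  of cyclic transversals.

  Let \<open>x\<close> be an extreme point, \<open>s\<^sub>i\<close> the support size of row \<open>i\<close>, and \<open>k\<close> the number of columns with a
  fractional entry. The following observations force \<open>x\<close> to be integral.

  \<^item> All tight inequalities of one column impose a single linear equation on a direction supported on
    \<open>x\<close> (\<open>tight_slopes_agree_up_to_sign\<close>), because two different ones can only be tight
    together if all entries but two are integral. Counting unknowns against equations gives
    \<open>\<Sum>\<^sub>i (s\<^sub>i - 1) \<le> k\<close> (\<open>extreme_point_support_bound\<close>).
  \<^item> Row \<open>i\<close> is fractional in at most \<open>2 (s\<^sub>i - 1)\<close> columns (\<open>card_mixed_le\<close>), while a fractional column
    has at least two fractional entries by parity. Counting the fractional entries in both ways
    leaves exactly two in each fractional column (\<open>extreme_point_mixed_column\<close>).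
  \<^item> Some cyclic transversal \<open>\<xi>\<close> lies in the support of \<open>x\<close> (\<open>exists_cyclic_in_support\<close>). In a column with
    only two fractional entries, \<open>\<xi>\<close> satisfies with equality every inequality that is tight at \<open>x\<close>
    (\<open>tight_at_cyclic_in_support\<close>). Hence \<open>x\<close> can be moved a little both towards \<open>\<xi>\<close> and away from it,
    and extremality leaves only \<open>x = \<xi>\<close>.
\<close>

section \<open>Vectors over the two-element field\<close>

lemma scalar_product_add:
  fixes \<eta> :: "bit ^ 'd::finite"
  shows "scalar_product \<eta> (a + b) = scalar_product \<eta> a + scalar_product \<eta> b"
  unfolding scalar_product_def vector_add_component distrib_left sum.distrib ..

lemma scalar_product_add_left:
  fixes \<eta> :: "bit ^ 'd::finite"
  shows "scalar_product (\<eta> + \<theta>) a = scalar_product \<eta> a + scalar_product \<theta> a"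
  unfolding scalar_product_def vector_add_component distrib_right sum.distrib ..

lemma scalar_product_zero [simp]: "scalar_product (\<eta> :: bit ^ 'd::finite) 0 = 0"
  by (simp add: scalar_product_def)

lemma scalar_product_zero_left: "scalar_product 0 (v :: bit ^ 'd::finite) = 0"
  by (simp add: scalar_product_def)

lemma scalar_product_sum:
  fixes \<eta> :: "bit ^ 'd::finite"
  shows "scalar_product \<eta> (sum f A) = (\<Sum>i\<in>A. scalar_product \<eta> (f i))"
  by (induction A rule: infinite_finite_induct) (auto simp: scalar_product_add)

lemma bit_vec_add_self [simp]: "a + a = (0 :: bit ^ 'd::finite)"
  by (simp add: vec_eq_iff)

lemma bit_vec_add_eq_0_iff: "a + b = (0 :: bit ^ 'd::finite) \<longleftrightarrow> a = b"
  by (metis add.assoc add.right_neutral bit_vec_add_self add_0)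

lemma bit_cases: "(b :: bit) = 0 \<or> b = 1"
  by (cases b) auto

lemma sum_bit_eq_1_iff:
  fixes f :: "'a \<Rightarrow> bit"
  assumes "finite A"
  shows "(\<Sum>i\<in>A. f i) = 1 \<longleftrightarrow> odd (card {i \<in> A. f i = 1})"
  using assms
proof (induction A)
  case (insert a A)
  have "{i \<in> insert a A. f i = 1} = (if f a = 1 then insert a {i \<in> A. f i = 1} else {i \<in> A. f i = 1})"
    by auto
  then show ?case
    using insert bit_cases[of "f a"] bit_cases[of "sum f A"] by auto
qed simp

text \<open>
  A coordinate functional works if some coordinate of \<open>a\<close> is \<open>1\<close> where that of \<open>b\<close> is \<open>0\<close>. Otherwise
  \<open>a\<close> lies below \<open>b\<close> coordinatewise, and the sum of a coordinate where both are \<open>1\<close> and one where they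
  differ is \<open>1\<close> on \<open>a\<close> and \<open>0\<close> on \<open>b\<close>.
\<close>

lemma exists_functional_separating:
  fixes a b :: "bit ^ 'd::finite"
  assumes "a \<noteq> 0" "a \<noteq> b"
  shows "\<exists>\<eta>. scalar_product \<eta> a = 1 \<and> scalar_product \<eta> b = 0"
proof -
  have axis: "scalar_product (axis k 1) v = v $ k" for k and v :: "bit ^ 'd"
  proof -
    have "scalar_product (axis k 1) v = (\<Sum>i\<in>UNIV. if i = k then v $ i else 0)"
      unfolding scalar_product_def by (intro sum.cong) (auto simp: axis_def)
    then show ?thesis by simp
  qed
  show ?thesis
  proof (cases "\<exists>k. a $ k = 1 \<and> b $ k = 0")
    case True
    then show ?thesis using axis by metis
  next
    case False
    obtain k where "a $ k \<noteq> 0" using assms by (auto simp: vec_eq_iff)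
    then have k: "a $ k = 1" "b $ k = 1" using False bit_cases by metis+
    obtain l where "a $ l \<noteq> b $ l" using assms by (auto simp: vec_eq_iff)
    then have l: "a $ l = 0" "b $ l = 1" using False bit_cases by metis+
    show ?thesis
      using k l by (intro exI[of _ "axis k 1 + axis l 1"]) (auto simp: scalar_product_add_left axis)
  qed
qed

section \<open>Finite systems of linear conditions\<close>

text \<open>
  Slacks \<open>a\<close> change at rates \<open>b\<close> along a line; if the rate vanishes wherever the slack does, a small
  step in either direction keeps all slacks non-negative.
\<close>

lemma small_step_keeps_nonnegative:
  fixes a b :: "'j \<Rightarrow> real"
  assumes "finite J" and "\<And>j. j \<in> J \<Longrightarrow> 0 \<le> a j" and "\<And>j. j \<in> J \<Longrightarrow> a j = 0 \<Longrightarrow> b j = 0"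
  shows "\<exists>\<epsilon>>0. \<forall>j\<in>J. \<epsilon> * \<bar>b j\<bar> \<le> a j"
  using assms
proof (induction J)
  case empty
  then show ?case by (auto intro: exI[of _ 1])
next
  case (insert j J)
  then obtain \<epsilon> where \<epsilon>: "\<epsilon> > 0" "\<And>i. i \<in> J \<Longrightarrow> \<epsilon> * \<bar>b i\<bar> \<le> a i" by auto
  show ?case
  proof (cases "b j = 0")
    case True
    then show ?thesis using \<epsilon> insert.prems by (intro exI[of _ \<epsilon>]) auto
  next
    case False
    define \<epsilon>' where "\<epsilon>' = min \<epsilon> (a j / \<bar>b j\<bar>)"
    have "a j > 0" using False insert.prems by (metis insertI1 less_eq_real_def)
    then have "\<epsilon>' > 0" using \<epsilon> False by (simp add: \<epsilon>'_def)
    moreover have "\<epsilon>' * \<bar>b j\<bar> \<le> a j"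
    proof -
      have "\<epsilon>' * \<bar>b j\<bar> \<le> a j / \<bar>b j\<bar> * \<bar>b j\<bar>" by (intro mult_right_mono) (auto simp: \<epsilon>'_def)
      then show ?thesis using False by simp
    qed
    moreover have "\<epsilon>' * \<bar>b i\<bar> \<le> a i" if "i \<in> J" for i
    proof -
      have "\<epsilon>' * \<bar>b i\<bar> \<le> \<epsilon> * \<bar>b i\<bar>" by (intro mult_right_mono) (auto simp: \<epsilon>'_def)
      then show ?thesis using \<epsilon>(2)[OF that] by linarith
    qed
    ultimately show ?thesis by (intro exI[of _ \<epsilon>']) auto
  qed
qed

lemma exists_nonzero_orthogonal_in_subspace:
  fixes A :: "'a::euclidean_space set"
  assumes "subspace A" "finite J" "card J < dim A"
  shows "\<exists>\<delta>\<in>A. \<delta> \<noteq> 0 \<and> (\<forall>v\<in>J. v \<bullet> \<delta> = 0)"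
proof -
  define U where "U = {y \<in> UNIV. \<forall>x\<in>span J. orthogonal x y}"
  have "dim U + dim (span J) = dim (UNIV :: 'a set)"
    unfolding U_def by (rule dim_subspace_orthogonal_to_vectors) auto
  moreover have "dim (span J) \<le> card J" using assms(2) by (simp add: dim_le_card')
  moreover have "subspace U"
    unfolding U_def by (auto simp: subspace_def orthogonal_def inner_right_distrib)
  then have "dim {x + y |x y. x \<in> A \<and> y \<in> U} + dim (A \<inter> U) = dim A + dim U"
    using assms(1) by (intro dim_sums_Int)
  moreover have "dim {x + y |x y. x \<in> A \<and> y \<in> U} \<le> dim (UNIV :: 'a set)"
    by (simp add: dim_subset_UNIV)
  ultimately have "dim (A \<inter> U) \<noteq> 0" using assms(3) by linarith
  then obtain \<delta> where "\<delta> \<in> A \<inter> U" "\<delta> \<noteq> 0" by (auto simp: dim_eq_0)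
  then show ?thesis by (auto simp: U_def orthogonal_def span_base)
qed

text \<open>
  A homogeneous linear system has a non-zero solution as soon as it has more unknowns than equations:
  the unknowns are the entries in \<open>M\<close>, the equations are orthogonality to the members of \<open>J\<close>.
\<close>

lemma exists_nonzero_supported_orthogonal:
  fixes M :: "('m::finite \<times> 'k::finite) set" and J :: "(real ^ 'k ^ 'm) set"
  assumes "finite J" "card J < card M"
  shows "\<exists>\<delta>. \<delta> \<noteq> 0 \<and> (\<forall>i \<omega>. (i, \<omega>) \<notin> M \<longrightarrow> \<delta> $ i $ \<omega> = 0) \<and> (\<forall>v\<in>J. v \<bullet> \<delta> = 0)"
proof -
  define A :: "(real ^ 'k ^ 'm) set" where "A = {\<delta>. \<forall>i \<omega>. (i, \<omega>) \<notin> M \<longrightarrow> \<delta> $ i $ \<omega> = 0}"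
  define E where "E = (\<lambda>(i, \<omega>). axis i (axis \<omega> 1) :: real ^ 'k ^ 'm) ` M"
  have "inj_on (\<lambda>(i, \<omega>). axis i (axis \<omega> 1) :: real ^ 'k ^ 'm) M"
    by (auto simp: inj_on_def axis_eq_axis)
  then have "card E = card M" by (simp add: E_def card_image)
  have "E \<subseteq> Basis" by (auto simp: E_def Basis_vec_def)
  then have "independent E" using independent_Basis independent_mono by blast
  moreover have "E \<subseteq> A" by (auto simp: E_def A_def axis_def split: if_splits)
  ultimately have "card E \<le> dim A" by (rule independent_card_le_dim[rotated])
  moreover have "subspace A" by (auto simp: A_def subspace_def)
  ultimately show ?thesis
    using exists_nonzero_orthogonal_in_subspace[of A J] assms \<open>card E = card M\<close> by (auto simp: A_def)
qed


section \<open>Parity inequalities in one column\<close>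

definition ones :: "bit ^ 'd::finite \<Rightarrow> real ^ (bit ^ 'd) ^ 'n::finite \<Rightarrow> 'n \<Rightarrow> real" where
  "ones \<eta> x i = (\<Sum>\<omega> | scalar_product \<eta> \<omega> = 1. x $ i $ \<omega>)"

text \<open>
  The sum of these values over all \<open>i\<close> is the left-hand side of the LOS inequality for \<open>\<eta>\<close> and \<open>I\<close>,
  namely the \<open>\<ell>\<^sub>1\<close>-distance between the column \<open>ones \<eta> x\<close> and the indicator vector of \<open>I\<close>.
\<close>

definition mismatch :: "bit ^ 'd::finite \<Rightarrow> 'n set \<Rightarrow> real ^ (bit ^ 'd) ^ 'n::finite \<Rightarrow> 'n \<Rightarrow> real" where
  "mismatch \<eta> I x i = (if i \<in> I then 1 - ones \<eta> x i else ones \<eta> x i)"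

text \<open>
  The rate at which the sum of mismatches grows in direction \<open>\<delta>\<close>, see
  \<open>mismatch_sum_add_scaleR\<close> below.
\<close>

definition slope :: "bit ^ 'd::finite \<Rightarrow> 'n set \<Rightarrow> real ^ (bit ^ 'd) ^ 'n::finite \<Rightarrow> real" where
  "slope \<eta> I \<delta> = (\<Sum>i\<in>UNIV. if i \<in> I then - ones \<eta> \<delta> i else ones \<eta> \<delta> i)"

definition supp :: "real ^ 'k ^ 'n \<Rightarrow> 'n \<Rightarrow> 'k set" where
  "supp x i = {\<omega>. x $ i $ \<omega> \<noteq> 0}"

text \<open>
  For a row of a non-negative matrix with row sums \<open>1\<close> this says that the entry \<open>ones \<eta> x i\<close> of the
  column \<open>\<eta>\<close> is fractional. The condition on the support lends itself to counting.
\<close>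

definition mixed :: "bit ^ 'd::finite \<Rightarrow> real ^ (bit ^ 'd) ^ 'n \<Rightarrow> 'n \<Rightarrow> bool" where
  "mixed \<eta> x i \<longleftrightarrow> (\<exists>\<alpha>\<in>supp x i. \<exists>\<beta>\<in>supp x i. scalar_product \<eta> \<alpha> \<noteq> scalar_product \<eta> \<beta>)"

lemma ones_add_scaleR: "ones \<eta> (x + c *\<^sub>R \<delta>) i = ones \<eta> x i + c * ones \<eta> \<delta> i"
  by (simp add: ones_def sum.distrib sum_distrib_left)

lemma mismatch_sum_add_scaleR:
  "(\<Sum>i\<in>UNIV. mismatch \<eta> I (x + c *\<^sub>R \<delta>) i) = (\<Sum>i\<in>UNIV. mismatch \<eta> I x i) + c * slope \<eta> I \<delta>"
  unfolding slope_def sum_distrib_left sum.distrib[symmetric]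
  by (intro sum.cong) (auto simp: mismatch_def ones_add_scaleR)

lemma convex_mismatch_sum:
  fixes \<eta> :: "bit ^ 'd::finite" and I :: "'n::finite set"
  shows "convex {x. 1 \<le> (\<Sum>i\<in>UNIV. mismatch \<eta> I x i)}"
proof (rule convexI, unfold mem_Collect_eq)
  fix x y :: "real ^ (bit ^ 'd) ^ 'n" and u v :: real
  assume xy: "1 \<le> (\<Sum>i\<in>UNIV. mismatch \<eta> I x i)" "1 \<le> (\<Sum>i\<in>UNIV. mismatch \<eta> I y i)"
    and uv: "0 \<le> u" "0 \<le> v" "u + v = 1"
  have "mismatch \<eta> I (u *\<^sub>R x + v *\<^sub>R y) i = u * mismatch \<eta> I x i + v * mismatch \<eta> I y i" for i
  proof -
    have "ones \<eta> (u *\<^sub>R x + v *\<^sub>R y) i = u * ones \<eta> x i + v * ones \<eta> y i"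
      by (simp add: ones_def sum.distrib sum_distrib_left)
    then show ?thesis using uv by (simp add: mismatch_def algebra_simps)
  qed
  then have "(\<Sum>i\<in>UNIV. mismatch \<eta> I (u *\<^sub>R x + v *\<^sub>R y) i)
      = u * (\<Sum>i\<in>UNIV. mismatch \<eta> I x i) + v * (\<Sum>i\<in>UNIV. mismatch \<eta> I y i)"
    by (simp add: sum.distrib sum_distrib_left)
  also have "\<dots> \<ge> u * 1 + v * 1"
    using uv xy by (intro add_mono mult_left_mono)
  finally show "1 \<le> (\<Sum>i\<in>UNIV. mismatch \<eta> I (u *\<^sub>R x + v *\<^sub>R y) i)" using uv by simp
qed

lemma ones_incidence_vector:
  "ones \<eta> (incidence_vector \<xi>) i = (if scalar_product \<eta> (\<xi> i) = 1 then 1 else 0)"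
proof -
  have "ones \<eta> (incidence_vector \<xi>) i = (\<Sum>\<omega> | scalar_product \<eta> \<omega> = 1. if \<xi> i = \<omega> then 1 else 0)"
    by (simp add: ones_def incidence_vector_def)
  also have "\<dots> = (if scalar_product \<eta> (\<xi> i) = 1 then 1 else 0)"
    by (subst sum.delta'[OF finite]) auto
  finally show ?thesis .
qed

lemma mismatch_incidence_vector:
  "mismatch \<eta> I (incidence_vector \<xi>) i = (if (scalar_product \<eta> (\<xi> i) = 1) \<noteq> (i \<in> I) then 1 else 0)"
  by (simp add: mismatch_def ones_incidence_vector)

lemma even_card_differences_iff:
  fixes A B :: "'n::finite set"
  shows "even (card {i. (i \<in> A) \<noteq> (i \<in> B)}) \<longleftrightarrow> (even (card A) \<longleftrightarrow> even (card B))"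
proof -
  have "{i. (i \<in> A) \<noteq> (i \<in> B)} = (A - B) \<union> (B - A)" by auto
  then have "card {i. (i \<in> A) \<noteq> (i \<in> B)} = card (A - B) + card (B - A)"
    by (simp add: card_Un_disjoint Diff_Int_distrib2 Int_Diff disjoint_iff)
  moreover have "card A = card (A - B) + card (A \<inter> B)"
    by (metis add.commute card_Int_Diff finite)
  moreover have "card B = card (B - A) + card (A \<inter> B)"
    by (metis add.commute card_Int_Diff finite Int_commute)
  ultimately show ?thesis by auto
qed

text \<open>
  At a \<open>0/1\<close>-column the sum of mismatches is the size of the symmetric difference of \<open>I\<close> with the
  support of the column; that support is even for a cyclic transversal, so the difference is odd.
\<close>

lemma mismatch_sum_cyclic:
  fixes \<xi> :: "'n::finite \<Rightarrow> bit ^ 'd::finite"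
  assumes "(\<Sum>i\<in>UNIV. \<xi> i) = 0" "odd (card I)"
  shows "\<exists>m. odd m \<and> (\<Sum>i\<in>UNIV. mismatch \<eta> I (incidence_vector \<xi>) i) = real m"
proof -
  define A where "A = {i. scalar_product \<eta> (\<xi> i) = 1}"
  have "(\<Sum>i\<in>UNIV. scalar_product \<eta> (\<xi> i)) = 0"
    using assms(1) by (simp flip: scalar_product_sum)
  then have "even (card A)"
    using sum_bit_eq_1_iff[of UNIV "\<lambda>i. scalar_product \<eta> (\<xi> i)"] by (simp add: A_def)
  then have "odd (card {i. (i \<in> A) \<noteq> (i \<in> I)})"
    using assms(2) by (simp only: even_card_differences_iff) simp
  moreover have "(\<Sum>i\<in>UNIV. mismatch \<eta> I (incidence_vector \<xi>) i) = real (card {i. (i \<in> A) \<noteq> (i \<in> I)})"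
    by (simp add: mismatch_incidence_vector A_def flip: sum.inter_filter)
  ultimately show ?thesis by blast
qed

section \<open>Transversal polytopes and stochastic matrices\<close>

definition stochastic :: "('n::finite \<Rightarrow> 'k::finite set) \<Rightarrow> (real ^ 'k ^ 'n) set" where
  "stochastic B = {x. (\<forall>i \<omega>. 0 \<le> x $ i $ \<omega>) \<and> (\<forall>i \<omega>. \<omega> \<notin> B i \<longrightarrow> x $ i $ \<omega> = 0) \<and>
     (\<forall>i. (\<Sum>\<omega>\<in>UNIV. x $ i $ \<omega>) = 1)}"

lemma convex_stochastic: "convex (stochastic B)"
  by (rule convexI) (simp add: stochastic_def sum.distrib flip: sum_distrib_left)

lemma incidence_vector_in_stochastic: "transversal B \<xi> \<Longrightarrow> incidence_vector \<xi> \<in> stochastic B"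
  by (auto simp: stochastic_def incidence_vector_def transversal_def)

lemma TP_subset_stochastic: "TP B \<subseteq> stochastic B"
  unfolding TP_def using incidence_vector_in_stochastic
  by (intro hull_minimal) (auto simp: convex_stochastic)

lemma CTP_subset_TP: "CTP B \<subseteq> TP B"
  unfolding TP_def CTP_def by (intro hull_mono) (auto simp: cyclic_transversal_def)

lemma LOS_inequality_iff:
  assumes "x \<in> stochastic B"
  shows "LOS_inequality B \<eta> I x \<longleftrightarrow> 1 \<le> (\<Sum>i\<in>UNIV. mismatch \<eta> I x i)"
proof -
  have 1: "(\<Sum>\<omega> | \<omega> \<in> B i \<and> scalar_product \<eta> \<omega> = 1. x $ i $ \<omega>) = ones \<eta> x i" for i
    unfolding ones_def using assms by (intro sum.mono_neutral_left) (auto simp: stochastic_def)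
  have "1 = (\<Sum>\<omega>\<in>B i. x $ i $ \<omega>)" for i
  proof -
    have "(\<Sum>\<omega>\<in>B i. x $ i $ \<omega>) = (\<Sum>\<omega>\<in>UNIV. x $ i $ \<omega>)"
      using assms by (intro sum.mono_neutral_left) (auto simp: stochastic_def)
    then show ?thesis using assms by (simp add: stochastic_def)
  qed
  also have "(\<Sum>\<omega>\<in>B i. x $ i $ \<omega>) = (\<Sum>\<omega> | \<omega> \<in> B i \<and> scalar_product \<eta> \<omega> = 0. x $ i $ \<omega>)
      + (\<Sum>\<omega> | \<omega> \<in> B i \<and> scalar_product \<eta> \<omega> = 1. x $ i $ \<omega>)" for i
    by (subst sum.union_disjoint[symmetric]) (auto intro!: sum.cong)
  finally have 0: "(\<Sum>\<omega> | \<omega> \<in> B i \<and> scalar_product \<eta> \<omega> = 0. x $ i $ \<omega>) = 1 - ones \<eta> x i" for i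
    unfolding 1 by (simp add: eq_diff_eq)
  have "(\<Sum>i\<in>UNIV. mismatch \<eta> I x i) = (\<Sum>i\<in>I. 1 - ones \<eta> x i) + (\<Sum>i\<in>UNIV - I. ones \<eta> x i)"
    unfolding mismatch_def by (subst sum.If_cases) (auto simp: Compl_eq_Diff_UNIV)
  then show ?thesis by (simp add: LOS_inequality_def 0 1)
qed

lemma CTP_satisfies_LOS:
  assumes "x \<in> CTP B" "odd (card I)"
  shows "LOS_inequality B \<eta> I x"
proof -
  have "convex (stochastic B \<inter> {x. 1 \<le> (\<Sum>i\<in>UNIV. mismatch \<eta> I x i)})"
    by (intro convex_Int convex_stochastic convex_mismatch_sum)
  moreover have "incidence_vector \<xi> \<in> stochastic B \<inter> {x. 1 \<le> (\<Sum>i\<in>UNIV. mismatch \<eta> I x i)}"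
    if "cyclic_transversal B \<xi>" for \<xi>
  proof -
    obtain m where "odd m" "(\<Sum>i\<in>UNIV. mismatch \<eta> I (incidence_vector \<xi>) i) = real m"
      using mismatch_sum_cyclic[of \<xi> I \<eta>] assms(2) \<open>cyclic_transversal B \<xi>\<close>
      by (auto simp: cyclic_transversal_def)
    moreover have "1 \<le> m" using \<open>odd m\<close> by (cases m) auto
    moreover have "incidence_vector \<xi> \<in> stochastic B"
      using that by (simp add: incidence_vector_in_stochastic cyclic_transversal_def)
    ultimately show ?thesis by simp
  qed
  ultimately have "CTP B \<subseteq> stochastic B \<inter> {x. 1 \<le> (\<Sum>i\<in>UNIV. mismatch \<eta> I x i)}"
    unfolding CTP_def by (intro hull_minimal) auto
  then show ?thesis using assms(1) LOS_inequality_iff by blast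
qed

section \<open>The relaxation given by three functionals\<close>

text \<open>
  The only properties of the plane spanned by the blocks that the argument needs: \<open>V\<close> plays the role
  of the plane, \<open>C\<close> that of its three non-zero functionals.
\<close>

locale three_functionals =
  fixes B :: "'n::finite \<Rightarrow> (bit ^ 'd::finite) set"
    and V C :: "(bit ^ 'd) set"
  assumes block_subset: "B i \<subseteq> V"
    and zero_mem: "0 \<in> V"
    and add_mem: "\<lbrakk>u \<in> V; v \<in> V\<rbrakk> \<Longrightarrow> u + v \<in> V"
    and card_C: "card C = 3"
    and card_nonvanishing: "\<lbrakk>v \<in> V; v \<noteq> 0\<rbrakk> \<Longrightarrow> card {\<eta> \<in> C. scalar_product \<eta> v = 1} = 2"
begin

text \<open>
  LOS inequalities are imposed only for the three functionals in \<open>C\<close>. This set contains the points of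
  \<open>TP B\<close> that satisfy all of them, and it is already contained in \<open>CTP B\<close>.
\<close>

definition relaxation :: "(real ^ (bit ^ 'd) ^ 'n) set" where
  "relaxation = {x \<in> stochastic B.
     \<forall>\<eta>\<in>C. \<forall>I. odd (card I) \<longrightarrow> 1 \<le> (\<Sum>i\<in>UNIV. mismatch \<eta> I x i)}"

lemma eq_if_two_functionals_agree:
  assumes "u \<in> V" "v \<in> V" "\<eta> \<in> C" "\<theta> \<in> C" "\<eta> \<noteq> \<theta>"
    and "scalar_product \<eta> u = scalar_product \<eta> v" "scalar_product \<theta> u = scalar_product \<theta> v"
  shows "u = v"
proof (rule ccontr)
  assume "u \<noteq> v"
  then have "u + v \<noteq> 0" by (simp add: bit_vec_add_eq_0_iff)
  then have "card {\<zeta> \<in> C. scalar_product \<zeta> (u + v) = 1} = 2"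
    using card_nonvanishing add_mem assms by blast
  moreover have "{\<zeta> \<in> C. scalar_product \<zeta> (u + v) = 1} \<subseteq> C - {\<eta>, \<theta>}"
    using assms by (auto simp: scalar_product_add)
  moreover have "card (C - {\<eta>, \<theta>}) = 1"
    using assms card_C by (subst card_Diff_subset) auto
  ultimately show False
    using card_mono[OF finite, of "{\<zeta> \<in> C. scalar_product \<zeta> (u + v) = 1}" "C - {\<eta>, \<theta>}"] by simp
qed

lemma sum_mem: "(\<And>i. i \<in> A \<Longrightarrow> f i \<in> V) \<Longrightarrow> sum f A \<in> V"
  by (induction A rule: infinite_finite_induct) (auto simp: zero_mem add_mem)

context
  fixes x :: "real ^ (bit ^ 'd) ^ 'n"
  assumes x: "x \<in> relaxation"
begin

lemma nonneg: "0 \<le> x $ i $ \<omega>"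
  and row_sum: "(\<Sum>\<omega>\<in>UNIV. x $ i $ \<omega>) = 1"
  and los: "\<eta> \<in> C \<Longrightarrow> odd (card I) \<Longrightarrow> 1 \<le> (\<Sum>i\<in>UNIV. mismatch \<eta> I x i)"
  using x by (simp_all add: relaxation_def stochastic_def)

lemma supp_subset: "supp x i \<subseteq> B i" "supp x i \<subseteq> V"
proof -
  have "x \<in> stochastic B" using x by (simp add: relaxation_def)
  then show *: "supp x i \<subseteq> B i" by (auto simp: stochastic_def supp_def)
  show "supp x i \<subseteq> V" using * block_subset by blast
qed

lemma supp_nonempty: "supp x i \<noteq> {}"
proof
  assume "supp x i = {}"
  then have "(\<Sum>\<omega>\<in>UNIV. x $ i $ \<omega>) = 0" by (intro sum.neutral) (auto simp: supp_def)
  then show False by (simp add: row_sum)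
qed

lemma exists_selection: "\<exists>\<xi>. \<forall>i. \<xi> i \<in> supp x i"
  using supp_nonempty by (intro choice) blast

lemma ones_bounds: "0 \<le> ones \<eta> x i" "ones \<eta> x i \<le> 1"
proof -
  show "0 \<le> ones \<eta> x i" by (simp add: ones_def sum_nonneg nonneg)
  have "ones \<eta> x i \<le> (\<Sum>\<omega>\<in>UNIV. x $ i $ \<omega>)"
    unfolding ones_def by (intro sum_mono2) (auto simp: nonneg)
  then show "ones \<eta> x i \<le> 1" by (simp add: row_sum)
qed

lemma ones_mixed:
  assumes "mixed \<eta> x i"
  shows "0 < ones \<eta> x i" "ones \<eta> x i < 1"
proof -
  obtain \<alpha> \<beta> where *: "x $ i $ \<alpha> \<noteq> 0" "x $ i $ \<beta> \<noteq> 0" "scalar_product \<eta> \<alpha> = 1" "scalar_product \<eta> \<beta> = 0"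
  proof -
    obtain \<alpha> \<beta> where "x $ i $ \<alpha> \<noteq> 0" "x $ i $ \<beta> \<noteq> 0" "scalar_product \<eta> \<alpha> \<noteq> scalar_product \<eta> \<beta>"
      using assms by (auto simp: mixed_def supp_def)
    then show ?thesis
      using that[of \<alpha> \<beta>] that[of \<beta> \<alpha>] bit_cases[of "scalar_product \<eta> \<alpha>"] bit_cases[of "scalar_product \<eta> \<beta>"]
      by auto
  qed
  then have pos: "x $ i $ \<alpha> > 0" "x $ i $ \<beta> > 0"
    using nonneg[of i \<alpha>] nonneg[of i \<beta>] by auto
  show "0 < ones \<eta> x i"
    unfolding ones_def by (rule sum_pos2[of _ \<alpha>]) (auto simp: * pos nonneg)
  have "ones \<eta> x i + x $ i $ \<beta> = (\<Sum>\<omega> \<in> insert \<beta> {\<omega>. scalar_product \<eta> \<omega> = 1}. x $ i $ \<omega>)"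
    using * by (simp add: ones_def)
  also have "\<dots> \<le> (\<Sum>\<omega>\<in>UNIV. x $ i $ \<omega>)"
    by (intro sum_mono2) (auto simp: nonneg)
  finally show "ones \<eta> x i < 1" using pos by (simp add: row_sum)
qed

lemma ones_not_mixed:
  assumes "\<not> mixed \<eta> x i" "\<alpha> \<in> supp x i" and "\<And>\<omega>. \<omega> \<notin> supp x i \<Longrightarrow> y $ i $ \<omega> = 0"
  shows "ones \<eta> y i = (if scalar_product \<eta> \<alpha> = 1 then \<Sum>\<omega>\<in>UNIV. y $ i $ \<omega> else 0)"
proof -
  have "scalar_product \<eta> \<omega> = scalar_product \<eta> \<alpha>" if "y $ i $ \<omega> \<noteq> 0" for \<omega>
    using assms that unfolding mixed_def by blast
  then have "y $ i $ \<omega> = 0" if "scalar_product \<eta> \<omega> \<noteq> scalar_product \<eta> \<alpha>" for \<omega>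
    using that by blast
  then show ?thesis
    unfolding ones_def using bit_cases[of "scalar_product \<eta> \<alpha>"]
    by (auto intro!: sum.mono_neutral_left sum.neutral) fastforce
qed

lemma ones_not_mixed_self:
  assumes "\<not> mixed \<eta> x i" "\<alpha> \<in> supp x i"
  shows "ones \<eta> x i = (if scalar_product \<eta> \<alpha> = 1 then 1 else 0)"
  using ones_not_mixed[OF assms, of x] row_sum by (simp add: supp_def)

lemma ones_not_mixed_direction:
  assumes "\<not> mixed \<eta> x i" "\<And>\<omega>. \<omega> \<notin> supp x i \<Longrightarrow> \<delta> $ i $ \<omega> = 0" "(\<Sum>\<omega>\<in>UNIV. \<delta> $ i $ \<omega>) = 0"
  shows "ones \<eta> \<delta> i = 0"
proof -
  obtain \<alpha> where "\<alpha> \<in> supp x i" using supp_nonempty by blast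
  from ones_not_mixed[of \<eta> i \<alpha> \<delta>, OF assms(1) this assms(2)] show ?thesis
    using assms(3) by simp
qed

lemma mismatch_nonneg: "0 \<le> mismatch \<eta> I x i"
  using ones_bounds[of \<eta> i] by (simp add: mismatch_def)

lemma mismatch_mixed:
  assumes "mixed \<eta> x i"
  shows "0 < mismatch \<eta> I x i" "mismatch \<eta> I x i < 1"
  using ones_mixed[OF assms] by (auto simp: mismatch_def)

text \<open>
  If an integral column were odd, its own support would be an odd set \<open>I\<close> without any mismatch.
\<close>

lemma unmixed_column_even:
  assumes "\<eta> \<in> C" "\<And>i. \<not> mixed \<eta> x i" "\<And>i. \<xi> i \<in> supp x i"
  shows "scalar_product \<eta> (\<Sum>i\<in>UNIV. \<xi> i) = 0"
proof (rule ccontr)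
  define I where "I = {i. scalar_product \<eta> (\<xi> i) = 1}"
  assume "scalar_product \<eta> (\<Sum>i\<in>UNIV. \<xi> i) \<noteq> 0"
  then have "odd (card I)"
    using sum_bit_eq_1_iff[of UNIV "\<lambda>i. scalar_product \<eta> (\<xi> i)"]
    by (simp add: I_def scalar_product_sum)
  then have "1 \<le> (\<Sum>i\<in>UNIV. mismatch \<eta> I x i)" using los assms(1) by blast
  moreover have "mismatch \<eta> I x i = 0" for i
    using ones_not_mixed_self[OF assms(2,3)] by (simp add: mismatch_def I_def)
  ultimately show False by simp
qed

text \<open>
  A column whose only fractional entry is the one in row \<open>j\<close> is at distance less than \<open>1\<close> from both of
  its roundings, and one of these two roundings is an odd set.
\<close>

lemma mixed_column_has_two_mixed_rows:
  assumes "\<eta> \<in> C" "mixed \<eta> x j"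
  shows "\<exists>k. k \<noteq> j \<and> mixed \<eta> x k"
proof (rule ccontr)
  assume "\<nexists>k. k \<noteq> j \<and> mixed \<eta> x k"
  then have unmixed: "\<And>i. i \<noteq> j \<Longrightarrow> \<not> mixed \<eta> x i" by blast
  obtain \<xi> where \<xi>: "\<And>i. \<xi> i \<in> supp x i" using exists_selection by blast
  (* The rounding of the column that is odd: row j is rounded up exactly if A is even. *)
  define A where "A = {i. i \<noteq> j \<and> scalar_product \<eta> (\<xi> i) = 1}"
  define I where "I = (if odd (card A) then A else insert j A)"
  have "odd (card I)" by (simp add: I_def A_def)
  then have "1 \<le> (\<Sum>i\<in>UNIV. mismatch \<eta> I x i)" using los assms(1) by blast
  also have "(\<Sum>i\<in>UNIV. mismatch \<eta> I x i) = mismatch \<eta> I x j + (\<Sum>i\<in>UNIV-{j}. mismatch \<eta> I x i)"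
    by (simp add: sum.remove)
  also have "(\<Sum>i\<in>UNIV-{j}. mismatch \<eta> I x i) = 0"
    using ones_not_mixed_self[OF unmixed \<xi>]
    by (intro sum.neutral) (auto simp: mismatch_def I_def A_def)
  also have "mismatch \<eta> I x j + 0 < 1" using mismatch_mixed[OF assms(2)] by simp
  finally show False by simp
qed

text \<open>
  Let \<open>D\<close> be the symmetric difference of \<open>I\<close> and \<open>I'\<close>. Each row in \<open>D\<close> contributes \<open>1\<close> to the sum of the
  two left-hand sides, which is \<open>2\<close>, and \<open>D\<close> has even size. So either \<open>D\<close> is empty, or it consists of two
  rows and the mismatches of all other rows vanish. In the second case the other rows are
  integral and do not move along \<open>\<delta>\<close>, whereas on \<open>D\<close> the two slopes have opposite signs.
\<close>

lemma tight_slopes_agree_up_to_sign: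
  assumes "odd (card I)" "odd (card I')"
    and tight: "(\<Sum>i\<in>UNIV. mismatch \<eta> I x i) = 1" "(\<Sum>i\<in>UNIV. mismatch \<eta> I' x i) = 1"
    and \<delta>: "\<And>i \<omega>. \<omega> \<notin> supp x i \<Longrightarrow> \<delta> $ i $ \<omega> = 0" "\<And>i. (\<Sum>\<omega>\<in>UNIV. \<delta> $ i $ \<omega>) = 0"
  shows "slope \<eta> I' \<delta> = slope \<eta> I \<delta> \<or> slope \<eta> I' \<delta> = - slope \<eta> I \<delta>"
proof (cases "I = I'")
  case False
  define D where "D = {i. (i \<in> I) \<noteq> (i \<in> I')}"
  have "D \<noteq> {}" using False by (auto simp: D_def)
  moreover have "even (card D)"
    unfolding D_def using assms(1,2) by (simp only: even_card_differences_iff)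
  ultimately have "2 \<le> card D"
    by (cases "card D" rule: nat.exhaust; cases "card D = 1") (auto simp: card_eq_0_iff)
  have "2 = (\<Sum>i\<in>UNIV. mismatch \<eta> I x i + mismatch \<eta> I' x i)"
    by (simp add: sum.distrib tight)
  also have "\<dots> = (\<Sum>i\<in>UNIV. (if i \<in> D then 1 else 0) + (if i \<in> D then 0 else 2 * mismatch \<eta> I x i))"
    by (intro sum.cong) (auto simp: D_def mismatch_def)
  also have "\<dots> = real (card D) + (\<Sum>i\<in>UNIV. if i \<in> D then 0 else 2 * mismatch \<eta> I x i)"
    by (simp add: sum.distrib flip: sum.inter_filter)
  finally have "(\<Sum>i\<in>UNIV. if i \<in> D then 0 else 2 * mismatch \<eta> I x i) \<le> 0"
    using \<open>2 \<le> card D\<close> by simp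
  moreover have "0 \<le> (\<Sum>i\<in>UNIV. if i \<in> D then 0 else 2 * mismatch \<eta> I x i)"
    by (intro sum_nonneg) (auto simp: mismatch_nonneg)
  ultimately have "(\<Sum>i\<in>UNIV. if i \<in> D then 0 else 2 * mismatch \<eta> I x i) = 0" by simp
  then have "\<And>i. (if i \<in> D then 0 else 2 * mismatch \<eta> I x i) = 0"
    by (subst (asm) sum_nonneg_eq_0_iff) (auto simp: mismatch_nonneg)
  then have zero: "mismatch \<eta> I x i = 0" if "i \<notin> D" for i using that by (metis (no_types) mult_eq_0_iff zero_neq_numeral)
  have "ones \<eta> \<delta> i = 0" if "i \<notin> D" for i
  proof -
    have "\<not> mixed \<eta> x i" using zero[OF that] mismatch_mixed(1)[of \<eta> i I] by auto
    then show ?thesis using ones_not_mixed_direction \<delta> by blast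
  qed
  then have "slope \<eta> I' \<delta> = - slope \<eta> I \<delta>"
    unfolding slope_def sum_negf[symmetric] by (intro sum.cong) (auto simp: D_def)
  then show ?thesis ..
qed simp

text \<open>
  Start with any transversal \<open>\<xi>\<close> of the supports and let \<open>\<sigma>\<close> be its sum. If \<open>\<sigma> \<noteq> 0\<close>, two functionals
  \<open>\<eta>\<close> and \<open>\<theta>\<close> are \<open>1\<close> on \<open>\<sigma>\<close>, so their columns are odd for \<open>\<xi>\<close> and must each have two fractional rows. A
  fractional row of column \<open>\<eta>\<close> permits replacing \<open>\<xi>(i)\<close> by \<open>\<xi>(i) + u\<close> with \<open>\<eta> u = 1\<close>; similarly for \<open>\<theta>\<close>
  and some \<open>v\<close>. Either one of these changes alters both parities and equals \<open>\<sigma>\<close>, or their sum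
  equals \<open>\<sigma>\<close>. The second option needs the two changes in different rows.
\<close>

lemma exists_cyclic_in_support: "\<exists>\<xi>. (\<forall>i. \<xi> i \<in> supp x i) \<and> (\<Sum>i\<in>UNIV. \<xi> i) = 0"
proof -
  obtain \<xi> where \<xi>: "\<And>i. \<xi> i \<in> supp x i" using exists_selection by blast
  define \<sigma> where "\<sigma> = (\<Sum>i\<in>UNIV. \<xi> i)"
  have "\<sigma> \<in> V" unfolding \<sigma>_def using \<xi> supp_subset by (intro sum_mem) blast
  have sum_update: "(\<Sum>i\<in>UNIV. (\<zeta>(j := \<zeta> j + u)) i) = (\<Sum>i\<in>UNIV. \<zeta> i) + u" for \<zeta> :: "'n \<Rightarrow> bit ^ 'd" and j u
  proof -
    have "(\<Sum>i\<in>UNIV. (\<zeta>(j := \<zeta> j + u)) i) = (\<Sum>i\<in>UNIV. \<zeta> i + (if i = j then u else 0))"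
      by (intro sum.cong) auto
    then show ?thesis by (simp add: sum.distrib)
  qed
  have move: "\<exists>u\<in>V. \<xi> i + u \<in> supp x i \<and> scalar_product \<eta> u = 1" if mixed: "mixed \<eta> x i" for \<eta> i
  proof -
    obtain \<alpha> \<beta> where "\<alpha> \<in> supp x i" "\<beta> \<in> supp x i" "scalar_product \<eta> \<alpha> \<noteq> scalar_product \<eta> \<beta>"
      using mixed unfolding mixed_def by blast
    then obtain \<alpha> where \<alpha>: "\<alpha> \<in> supp x i" "scalar_product \<eta> \<alpha> \<noteq> scalar_product \<eta> (\<xi> i)"
      by (cases "scalar_product \<eta> \<alpha> = scalar_product \<eta> (\<xi> i)") auto
    then have "scalar_product \<eta> (\<xi> i + \<alpha>) = 1"
      using bit_cases[of "scalar_product \<eta> \<alpha>"] bit_cases[of "scalar_product \<eta> (\<xi> i)"]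
      by (auto simp: scalar_product_add)
    moreover have "\<xi> i + (\<xi> i + \<alpha>) = \<alpha>" by (simp flip: add.assoc)
    moreover have "\<xi> i + \<alpha> \<in> V" using \<alpha> \<xi> supp_subset add_mem by blast
    ultimately show ?thesis using \<alpha> by metis
  qed
  show ?thesis
  proof (cases "\<sigma> = 0")
    case True
    then show ?thesis using \<xi> by (auto simp: \<sigma>_def)
  next
    case False
    then have "card {\<eta> \<in> C. scalar_product \<eta> \<sigma> = 1} = 2" using card_nonvanishing \<open>\<sigma> \<in> V\<close> by blast
    then obtain \<eta> \<theta> where "{\<eta> \<in> C. scalar_product \<eta> \<sigma> = 1} = {\<eta>, \<theta>}" "\<eta> \<noteq> \<theta>"
      by (meson card_2_iff)
    then have C: "\<eta> \<in> C" "\<theta> \<in> C" "\<eta> \<noteq> \<theta>" "scalar_product \<eta> \<sigma> = 1" "scalar_product \<theta> \<sigma> = 1" by blast+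
    have one_move: ?thesis if "u \<in> V" "\<xi> i + u \<in> supp x i" "scalar_product \<eta> u = 1" "scalar_product \<theta> u = 1" for i u
    proof -
      have "u = \<sigma>" using eq_if_two_functionals_agree[OF that(1) \<open>\<sigma> \<in> V\<close> C(1-3)] that C by simp
      then show ?thesis using that \<xi> sum_update[of \<xi> i u]
        by (intro exI[of _ "\<xi>(i := \<xi> i + u)"]) (auto simp: \<sigma>_def)
    qed
    obtain i1 i2 j where rows: "i1 \<noteq> i2" "mixed \<eta> x i1" "mixed \<eta> x i2" "mixed \<theta> x j"
      using unmixed_column_even[of \<eta> \<xi>] unmixed_column_even[of \<theta> \<xi>] mixed_column_has_two_mixed_rows C \<xi>
      unfolding \<sigma>_def by (metis bit_not_one_iff)
    (* Column \<eta> has two mixed rows, so one of them differs from j. *)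
    then obtain i where i: "i \<noteq> j" "mixed \<eta> x i" by metis
    obtain u where u: "u \<in> V" "\<xi> i + u \<in> supp x i" "scalar_product \<eta> u = 1" using move[OF i(2)] by blast
    obtain v where v: "v \<in> V" "\<xi> j + v \<in> supp x j" "scalar_product \<theta> v = 1" using move[OF rows(4)] by blast
    show ?thesis
    proof (cases "scalar_product \<theta> u = 1 \<or> scalar_product \<eta> v = 1")
      case True
      then show ?thesis using one_move u v by blast
    next
      case False
      then have "scalar_product \<theta> u = 0" "scalar_product \<eta> v = 0" using bit_cases by metis+
      then have "u + v = \<sigma>"
        using eq_if_two_functionals_agree[OF add_mem[OF u(1) v(1)] \<open>\<sigma> \<in> V\<close> C(1-3)] u v C
        by (simp add: scalar_product_add)
      define \<zeta> where "\<zeta> = \<xi>(i := \<xi> i + u)"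
      have "(\<Sum>k\<in>UNIV. (\<zeta>(j := \<zeta> j + v)) k) = \<sigma> + u + v"
        unfolding sum_update unfolding \<zeta>_def sum_update \<sigma>_def ..
      also have "\<dots> = 0" using \<open>u + v = \<sigma>\<close> by (simp add: add.assoc)
      finally show ?thesis
        using u v \<xi> i by (intro exI[of _ "\<zeta>(j := \<zeta> j + v)"]) (auto simp: \<zeta>_def)
    qed
  qed
qed

text \<open>
  A support of size two, \<open>{\<alpha>, \<beta>}\<close>, is separated by exactly the two functionals that are \<open>1\<close> on \<open>\<alpha> + \<beta>\<close>;
  for larger supports the bound is the total number \<open>3\<close> of functionals.
\<close>

lemma card_mixed_le:
  "card {\<eta> \<in> C. mixed \<eta> x i} + 2 \<le> 2 * card (supp x i)"
proof -
  have "card (supp x i) > 0" using supp_nonempty by (simp add: card_gt_0_iff)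
  then consider "card (supp x i) = 1" | "card (supp x i) = 2" | "card (supp x i) \<ge> 3" by linarith
  then show ?thesis
  proof cases
    case 1
    then obtain \<alpha> where "supp x i = {\<alpha>}" by (auto simp: card_1_singleton_iff)
    then have "{\<eta> \<in> C. mixed \<eta> x i} = {}" by (auto simp: mixed_def)
    then show ?thesis using 1 by simp
  next
    case 2
    then obtain \<alpha> \<beta> where \<alpha>\<beta>: "supp x i = {\<alpha>, \<beta>}" "\<alpha> \<noteq> \<beta>" by (auto simp: card_2_iff)
    have "mixed \<eta> x i \<longleftrightarrow> scalar_product \<eta> (\<alpha> + \<beta>) = 1" for \<eta>
      using bit_cases[of "scalar_product \<eta> \<alpha>"] bit_cases[of "scalar_product \<eta> \<beta>"]
      by (auto simp: mixed_def \<alpha>\<beta> scalar_product_add)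
    moreover have "\<alpha> + \<beta> \<in> V" using supp_subset[of i] add_mem \<alpha>\<beta> by auto
    moreover have "\<alpha> + \<beta> \<noteq> 0" using \<alpha>\<beta> by (simp add: bit_vec_add_eq_0_iff)
    ultimately show ?thesis using card_nonvanishing 2 by simp
  next
    case 3
    have "card {\<eta> \<in> C. mixed \<eta> x i} \<le> card C" by (intro card_mono) auto
    then show ?thesis using 3 card_C by linarith
  qed
qed

end

lemma extreme_point_direction_zero:
  assumes ext: "x extreme_point_of relaxation"
    and supp: "\<And>i \<omega>. \<omega> \<notin> supp x i \<Longrightarrow> \<delta> $ i $ \<omega> = 0"
    and rows: "\<And>i. (\<Sum>\<omega>\<in>UNIV. \<delta> $ i $ \<omega>) = 0"
    and slope: "\<And>\<eta> I. \<lbrakk>\<eta> \<in> C; odd (card I); (\<Sum>i\<in>UNIV. mismatch \<eta> I x i) = 1\<rbrakk> \<Longrightarrow> slope \<eta> I \<delta> = 0"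
  shows "\<delta> = 0"
proof (rule ccontr)
  assume "\<delta> \<noteq> 0"
  have x: "x \<in> relaxation" using ext by (simp add: extreme_point_of_def)
  obtain \<epsilon>1 where \<epsilon>1: "\<epsilon>1 > 0" "\<And>i \<omega>. \<epsilon>1 * \<bar>\<delta> $ i $ \<omega>\<bar> \<le> x $ i $ \<omega>"
    using small_step_keeps_nonnegative[of UNIV "\<lambda>(i, \<omega>). x $ i $ \<omega>" "\<lambda>(i, \<omega>). \<delta> $ i $ \<omega>"]
      nonneg[OF x] supp by (auto simp: supp_def)
  obtain \<epsilon>2 where \<epsilon>2: "\<epsilon>2 > 0"
    "\<And>\<eta> I. \<eta> \<in> C \<Longrightarrow> odd (card I) \<Longrightarrow> \<epsilon>2 * \<bar>slope \<eta> I \<delta>\<bar> \<le> (\<Sum>i\<in>UNIV. mismatch \<eta> I x i) - 1"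
    using small_step_keeps_nonnegative[of "C \<times> {I. odd (card I)}"
        "\<lambda>(\<eta>, I). (\<Sum>i\<in>UNIV. mismatch \<eta> I x i) - 1" "\<lambda>(\<eta>, I). slope \<eta> I \<delta>"]
      los[OF x] slope by fastforce
  define \<epsilon> where "\<epsilon> = min \<epsilon>1 \<epsilon>2"
  have "\<epsilon> > 0" using \<epsilon>1 \<epsilon>2 by (simp add: \<epsilon>_def)
  have mem: "x + c *\<^sub>R \<delta> \<in> relaxation" if c: "\<bar>c\<bar> = \<epsilon>" for c
  proof -
    have bound: "- (e * \<bar>t\<bar>) \<le> c * t" if "\<epsilon> \<le> e" for e t :: real
    proof -
      have "\<bar>c * t\<bar> \<le> e * \<bar>t\<bar>" using that c by (auto simp: abs_mult intro: mult_right_mono)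
      then show ?thesis by linarith
    qed
    have "0 \<le> x $ i $ \<omega> + c * \<delta> $ i $ \<omega>" for i \<omega>
      using bound[of \<epsilon>1 "\<delta> $ i $ \<omega>"] \<epsilon>1(2)[of i \<omega>] by (simp add: \<epsilon>_def)
    moreover have "x $ i $ \<omega> + c * \<delta> $ i $ \<omega> = 0" if "\<omega> \<notin> B i" for i \<omega>
      using supp[of \<omega> i] x that by (simp add: supp_def relaxation_def stochastic_def)
    moreover have "(\<Sum>\<omega>\<in>UNIV. x $ i $ \<omega> + c * \<delta> $ i $ \<omega>) = 1" for i
      by (simp add: sum.distrib row_sum[OF x] rows flip: sum_distrib_left)
    moreover have "1 \<le> (\<Sum>i\<in>UNIV. mismatch \<eta> I (x + c *\<^sub>R \<delta>) i)" if "\<eta> \<in> C" "odd (card I)" for \<eta> I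
      unfolding mismatch_sum_add_scaleR
      using bound[of \<epsilon>2 "slope \<eta> I \<delta>"] \<epsilon>2(2)[OF that] by (simp add: \<epsilon>_def)
    ultimately show ?thesis by (simp add: relaxation_def stochastic_def)
  qed
  have "x + \<epsilon> *\<^sub>R \<delta> \<in> relaxation" "x + (- \<epsilon>) *\<^sub>R \<delta> \<in> relaxation"
    using mem[of \<epsilon>] mem[of "- \<epsilon>"] \<open>\<epsilon> > 0\<close> by auto
  moreover have "x \<in> open_segment (x + \<epsilon> *\<^sub>R \<delta>) (x + (- \<epsilon>) *\<^sub>R \<delta>)"
  proof -
    have "midpoint (x + \<epsilon> *\<^sub>R \<delta>) (x + (- \<epsilon>) *\<^sub>R \<delta>) = x" by (simp add: midpoint_def flip: scaleR_2)
    moreover have "x + \<epsilon> *\<^sub>R \<delta> \<noteq> x + (- \<epsilon>) *\<^sub>R \<delta>"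
      using \<open>\<epsilon> > 0\<close> \<open>\<delta> \<noteq> 0\<close> by (simp flip: scaleR_minus_left)
    ultimately show ?thesis by (metis midpoint_in_open_segment)
  qed
  ultimately show False using ext by (auto simp: extreme_point_of_def)
qed

text \<open>
  If the bound failed, the entries in the support would outnumber the equations consisting of one
  for each row sum and one for each fractional column. A non-zero solution would be a direction in
  which the extreme point can move both ways.
\<close>

lemma extreme_point_support_bound:
  assumes ext: "x extreme_point_of relaxation"
  shows "(\<Sum>i\<in>UNIV. card (supp x i)) \<le> CARD('n) + card {\<eta> \<in> C. \<exists>i. mixed \<eta> x i}"
proof (rule ccontr)
  have x: "x \<in> relaxation" using ext by (simp add: extreme_point_of_def)
  define M where "M = (SIGMA i:UNIV. supp x i)"
  define row :: "'n \<Rightarrow> real ^ (bit ^ 'd) ^ 'n" where "row = (\<lambda>i. axis i (\<chi> \<omega>. 1))"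
  define col :: "bit ^ 'd \<Rightarrow> 'n set \<Rightarrow> real ^ (bit ^ 'd) ^ 'n"
    where "col = (\<lambda>\<eta> I. \<chi> i \<omega>. if scalar_product \<eta> \<omega> = 1 then if i \<in> I then -1 else 1 else 0)"
  (* By tight_slopes_agree_up_to_sign, one tight set T per column represents all of them. *)
  define T where "T = (\<lambda>\<eta>. SOME I. odd (card I) \<and> (\<Sum>i\<in>UNIV. mismatch \<eta> I x i) = 1)"
  define K where "K = {\<eta> \<in> C. \<exists>i. mixed \<eta> x i}"
  define J where "J = range row \<union> (\<lambda>\<eta>. col \<eta> (T \<eta>)) ` K"
  have row: "row i \<bullet> \<delta> = (\<Sum>\<omega>\<in>UNIV. \<delta> $ i $ \<omega>)" for i \<delta>
    by (simp add: row_def inner_axis' inner_vec_def[of "\<chi> \<omega>. 1"])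
  have col: "col \<eta> I \<bullet> \<delta> = slope \<eta> I \<delta>" for \<eta> I \<delta>
  proof -
    have "(\<chi> \<omega>. if scalar_product \<eta> \<omega> = 1 then if i \<in> I then -1 else 1 else 0) \<bullet> \<delta> $ i =
        (if i \<in> I then - ones \<eta> \<delta> i else ones \<eta> \<delta> i)" for i
      by (simp add: inner_vec_def ones_def sum_negf[symmetric] if_distrib[of "\<lambda>t. t * _"]
          sum.If_cases cong: if_cong)
    then show ?thesis unfolding inner_vec_def[of "col \<eta> I"] slope_def by (simp add: col_def)
  qed
  assume "\<not> ?thesis"
  then have less: "CARD('n) + card K < card M" by (simp add: M_def K_def)
  have "card J \<le> card (range row) + card ((\<lambda>\<eta>. col \<eta> (T \<eta>)) ` K)"
    unfolding J_def by (rule card_Un_le)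
  also have "\<dots> \<le> CARD('n) + card K" by (intro add_mono card_image_le) auto
  finally have "card J < card M" using less by linarith
  then obtain \<delta> where \<delta>: "\<delta> \<noteq> 0" "\<And>i \<omega>. (i, \<omega>) \<notin> M \<Longrightarrow> \<delta> $ i $ \<omega> = 0" "\<And>v. v \<in> J \<Longrightarrow> v \<bullet> \<delta> = 0"
    using exists_nonzero_supported_orthogonal[of J M] by (auto simp: J_def)
  have supp: "\<And>i \<omega>. \<omega> \<notin> supp x i \<Longrightarrow> \<delta> $ i $ \<omega> = 0" using \<delta>(2) by (simp add: M_def)
  have rows: "(\<Sum>\<omega>\<in>UNIV. \<delta> $ i $ \<omega>) = 0" for i using \<delta>(3)[of "row i"] by (simp add: J_def row)
  have "slope \<eta> I \<delta> = 0"
    if I: "\<eta> \<in> C" "odd (card I)" "(\<Sum>i\<in>UNIV. mismatch \<eta> I x i) = 1" for \<eta> I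
  proof (cases "\<eta> \<in> K")
    case True
    have T: "odd (card (T \<eta>)) \<and> (\<Sum>i\<in>UNIV. mismatch \<eta> (T \<eta>) x i) = 1"
      unfolding T_def by (rule someI[of _ I]) (use I in simp)
    have "slope \<eta> (T \<eta>) \<delta> = 0"
      using \<delta>(3)[of "col \<eta> (T \<eta>)"] True by (auto simp: J_def col)
    moreover have "slope \<eta> I \<delta> = slope \<eta> (T \<eta>) \<delta> \<or> slope \<eta> I \<delta> = - slope \<eta> (T \<eta>) \<delta>"
      by (rule tight_slopes_agree_up_to_sign[OF x]) (use T I supp rows in blast)+
    ultimately show ?thesis by auto
  next
    case False
    then have "\<not> mixed \<eta> x i" for i using I(1) by (auto simp: K_def)
    then have "ones \<eta> \<delta> i = 0" for i using ones_not_mixed_direction[OF x] supp rows by blast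
    then show ?thesis unfolding slope_def by (intro sum.neutral) auto
  qed
  then have "\<delta> = 0" using extreme_point_direction_zero[OF ext supp rows] by blast
  then show False using \<delta>(1) by simp
qed

text \<open>
  Count the pairs of a fractional column and a row that is fractional in it. By columns there are at
  least \<open>2 k\<close> of them, where \<open>k\<close> is the number of fractional columns; by rows there are at most
  \<open>2 \<Sum>\<^sub>i (s\<^sub>i - 1) \<le> 2 k\<close>, where \<open>s\<^sub>i\<close> is the size of the support of row \<open>i\<close>.
\<close>

lemma extreme_point_mixed_column:
  assumes ext: "x extreme_point_of relaxation" and "\<eta> \<in> C" "\<exists>i. mixed \<eta> x i"
  shows "card {i. mixed \<eta> x i} = 2"
proof -
  have x: "x \<in> relaxation" using ext by (simp add: extreme_point_of_def)
  define K where "K = {\<eta> \<in> C. \<exists>i. mixed \<eta> x i}"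
  have ge2: "2 \<le> card {i. mixed \<theta> x i}" if "\<theta> \<in> K" for \<theta>
  proof -
    obtain j where "\<theta> \<in> C" "mixed \<theta> x j" using \<open>\<theta> \<in> K\<close> by (auto simp: K_def)
    moreover obtain k where "k \<noteq> j" "mixed \<theta> x k"
      using mixed_column_has_two_mixed_rows[OF x] calculation by blast
    ultimately have "card {j, k} \<le> card {i. mixed \<theta> x i}" by (intro card_mono) auto
    then show ?thesis using \<open>k \<noteq> j\<close> by simp
  qed
  have "(\<Sum>\<theta>\<in>K. card {i. mixed \<theta> x i}) = (\<Sum>i\<in>UNIV. card {\<theta> \<in> K. mixed \<theta> x i})"
    using sum_multicount_gen[of UNIV K "\<lambda>i \<theta>. mixed \<theta> x i" "\<lambda>\<theta>. card {i. mixed \<theta> x i}"] by simp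
  also have "\<dots> = (\<Sum>i\<in>UNIV. card {\<theta> \<in> C. mixed \<theta> x i})"
    by (intro sum.cong arg_cong[of _ _ card]) (auto simp: K_def)
  finally have "(\<Sum>\<theta>\<in>K. card {i. mixed \<theta> x i}) + 2 * CARD('n)
      = (\<Sum>i\<in>UNIV. card {\<theta> \<in> C. mixed \<theta> x i} + 2)"
    unfolding sum.distrib by simp
  also have "\<dots> \<le> (\<Sum>i\<in>UNIV. 2 * card (supp x i))"
    by (intro sum_mono card_mixed_le[OF x])
  also have "\<dots> \<le> 2 * (CARD('n) + card K)"
    using extreme_point_support_bound[OF ext] by (simp add: K_def flip: sum_distrib_left)
  finally have le: "(\<Sum>\<theta>\<in>K. card {i. mixed \<theta> x i}) \<le> (\<Sum>\<theta>\<in>K. 2)" by simp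
  have "\<eta> \<in> K" using assms by (simp add: K_def)
  show ?thesis
  proof (rule ccontr)
    assume "card {i. mixed \<eta> x i} \<noteq> 2"
    then have "2 < card {i. mixed \<eta> x i}" using ge2[OF \<open>\<eta> \<in> K\<close>] by simp
    then have "(\<Sum>\<theta>\<in>K. 2) < (\<Sum>\<theta>\<in>K. card {i. mixed \<theta> x i})"
      using ge2 \<open>\<eta> \<in> K\<close> by (intro sum_strict_mono_ex1) auto
    then show False using le by simp
  qed
qed

text \<open>
  Outside the two fractional rows \<open>x\<close> and \<open>\<xi>\<close> have the same mismatches, which are integers. At \<open>x\<close>
  they sum to less than \<open>1\<close>, because the fractional rows contribute a positive amount, and hence
  to \<open>0\<close>. So \<open>\<xi>\<close> has at most two mismatches, and their number is odd.
\<close>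

lemma tight_at_cyclic_in_support:
  assumes x: "x \<in> relaxation" and few: "card {i. mixed \<eta> x i} = 2 \<or> (\<forall>i. \<not> mixed \<eta> x i)"
    and \<xi>: "\<And>i. \<xi> i \<in> supp x i" "(\<Sum>i\<in>UNIV. \<xi> i) = 0"
    and I: "odd (card I)" "(\<Sum>i\<in>UNIV. mismatch \<eta> I x i) = 1"
  shows "(\<Sum>i\<in>UNIV. mismatch \<eta> I (incidence_vector \<xi>) i) = 1"
proof -
  have unmixed: "mismatch \<eta> I (incidence_vector \<xi>) i = mismatch \<eta> I x i" if "\<not> mixed \<eta> x i" for i
    using ones_not_mixed_self[OF x that \<xi>(1)] by (simp add: mismatch_def ones_incidence_vector)
  from few show ?thesis
  proof
    assume "\<forall>i. \<not> mixed \<eta> x i"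
    then show ?thesis using unmixed I by simp
  next
    assume "card {i. mixed \<eta> x i} = 2"
    then obtain j k where jk: "{i. mixed \<eta> x i} = {j, k}" "j \<noteq> k" by (auto simp: card_2_iff)
    then have mixed: "mixed \<eta> x j" "mixed \<eta> x k" "\<And>i. i \<noteq> j \<Longrightarrow> i \<noteq> k \<Longrightarrow> \<not> mixed \<eta> x i" by blast+
    have split: "(\<Sum>i\<in>UNIV. f i) = f j + f k + (\<Sum>i\<in>-{j, k}. f i)" for f :: "'n \<Rightarrow> real"
      using jk(2) by (simp add: Compl_eq_Diff_UNIV sum_diff)
    have rest: "(\<Sum>i\<in>-{j, k}. mismatch \<eta> I (incidence_vector \<xi>) i) = (\<Sum>i\<in>-{j, k}. mismatch \<eta> I x i)"
      using unmixed mixed(3) by (intro sum.cong) auto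
    define m where "m = card {i \<in> -{j, k}. (scalar_product \<eta> (\<xi> i) = 1) \<noteq> (i \<in> I)}"
    have m: "(\<Sum>i\<in>-{j, k}. mismatch \<eta> I (incidence_vector \<xi>) i) = real m"
      unfolding m_def mismatch_incidence_vector by (subst sum.inter_filter[symmetric]) auto
    have "real m < 1"
      using split[of "mismatch \<eta> I x"] rest m I mismatch_mixed(1)[OF x] mixed by (smt (verit))
    then have "(\<Sum>i\<in>UNIV. mismatch \<eta> I (incidence_vector \<xi>) i) \<le> 2"
      unfolding split m by (simp add: mismatch_incidence_vector)
    then show ?thesis using mismatch_sum_cyclic[OF \<xi>(2) I(1), of \<eta>]
      by (auto elim!: oddE)
  qed
qed

lemma extreme_point_is_cyclic_transversal:
  assumes ext: "x extreme_point_of relaxation"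
  shows "\<exists>\<xi>. cyclic_transversal B \<xi> \<and> x = incidence_vector \<xi>"
proof -
  have x: "x \<in> relaxation" using ext by (simp add: extreme_point_of_def)
  obtain \<xi> where \<xi>: "\<And>i. \<xi> i \<in> supp x i" "(\<Sum>i\<in>UNIV. \<xi> i) = 0"
    using exists_cyclic_in_support[OF x] by blast
  define \<delta> where "\<delta> = incidence_vector \<xi> - x"
  have "\<delta> = 0"
  proof (rule extreme_point_direction_zero[OF ext])
    show "\<delta> $ i $ \<omega> = 0" if "\<omega> \<notin> supp x i" for i \<omega>
      using that \<xi>(1)[of i] by (auto simp: \<delta>_def incidence_vector_def supp_def)
    show "(\<Sum>\<omega>\<in>UNIV. \<delta> $ i $ \<omega>) = 0" for i
      by (simp add: \<delta>_def incidence_vector_def sum_subtractf row_sum[OF x])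
    show "slope \<eta> I \<delta> = 0"
      if I: "\<eta> \<in> C" "odd (card I)" "(\<Sum>i\<in>UNIV. mismatch \<eta> I x i) = 1" for \<eta> I
    proof -
      have "(\<Sum>i\<in>UNIV. mismatch \<eta> I (x + 1 *\<^sub>R \<delta>) i) = 1"
        using tight_at_cyclic_in_support[OF x _ \<xi> I(2,3)] extreme_point_mixed_column[OF ext I(1)]
        by (auto simp: \<delta>_def)
      then show ?thesis unfolding mismatch_sum_add_scaleR using I(3) by simp
    qed
  qed
  then have "x = incidence_vector \<xi>" by (simp add: \<delta>_def)
  moreover have "\<xi> i \<in> B i" for i using \<xi>(1)[of i] supp_subset(1)[OF x, of i] by blast
  then have "cyclic_transversal B \<xi>" using \<xi>(2) by (simp add: cyclic_transversal_def transversal_def)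
  ultimately show ?thesis by blast
qed

lemma relaxation_Int:
  "relaxation = stochastic B \<inter>
    (\<Inter>\<eta>\<in>C. \<Inter>I\<in>{I. odd (card I)}. {x. 1 \<le> (\<Sum>i\<in>UNIV. mismatch \<eta> I x i)})"
  by (auto simp: relaxation_def)

lemma compact_relaxation: "compact relaxation"
proof -
  have "closed (stochastic B)"
    unfolding stochastic_def
    by (intro closed_Collect_conj closed_Collect_all closed_Collect_imp closed_Collect_le
        closed_Collect_eq continuous_intros) auto
  moreover have "continuous_on UNIV (\<lambda>x. mismatch \<eta> I x i)" for \<eta> I i
    by (cases "i \<in> I") (auto simp: mismatch_def ones_def intro!: continuous_intros)
  then have "closed {x. 1 \<le> (\<Sum>i\<in>UNIV. mismatch \<eta> I x i)}" for \<eta> I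
    by (intro closed_Collect_le continuous_on_sum continuous_on_const) auto
  ultimately have "closed relaxation"
    unfolding relaxation_Int by (intro closed_Int closed_INT ballI)
  moreover have "norm x \<le> real CARD('n) * real CARD(bit ^ 'd)" if "x \<in> relaxation" for x
  proof -
    have entry: "\<bar>x $ i $ \<omega>\<bar> \<le> 1" for i \<omega>
      using nonneg[OF that] row_sum[OF that, of i] member_le_sum[of \<omega> UNIV "\<lambda>\<omega>. x $ i $ \<omega>"] by simp
    have "norm x \<le> (\<Sum>i\<in>UNIV. norm (x $ i))" by (simp add: norm_vec_def L2_set_le_sum)
    also have "\<dots> \<le> (\<Sum>i\<in>(UNIV::'n set). \<Sum>\<omega>\<in>(UNIV::(bit ^ 'd) set). 1)"
      by (intro sum_mono order_trans[OF norm_le_l1_cart] entry)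
    finally show ?thesis by simp
  qed
  then have "bounded relaxation" by (auto simp: bounded_iff)
  ultimately show ?thesis by (simp add: compact_eq_bounded_closed)
qed

lemma convex_relaxation: "convex relaxation"
  unfolding relaxation_Int by (intro convex_Int convex_INT convex_stochastic convex_mismatch_sum)

lemma relaxation_subset_CTP: "relaxation \<subseteq> CTP B"
proof -
  have "relaxation = convex hull {x. x extreme_point_of relaxation}"
    by (rule Krein_Milman_Minkowski[OF compact_relaxation convex_relaxation])
  also have "\<dots> \<subseteq> CTP B"
    unfolding CTP_def using extreme_point_is_cyclic_transversal by (intro hull_mono) auto
  finally show ?thesis .
qed

end

text \<open>
  For a basis \<open>a, b\<close> of the plane, take \<open>\<eta>\<close> and \<open>\<theta>\<close> that restrict to the dual basis, together with
  \<open>\<eta> + \<theta>\<close>. LOS inequalities are only given for non-zero functionals, hence the condition \<open>0 \<notin> C\<close>.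
\<close>

lemma exists_three_functionals:
  fixes B :: "'n::finite \<Rightarrow> (bit ^ 'd::finite) set"
  assumes "block_rank B = 2"
  shows "\<exists>V C. three_functionals B V C \<and> 0 \<notin> C"
proof -
  define V where "V = vec.span (\<Union>i. B i)"
  obtain E where E: "E \<subseteq> V" "vec.independent E" "V \<subseteq> vec.span E" "card E = vec.dim V"
    using vec.basis_exists by blast
  then have "card E = 2" using assms by (simp add: block_rank_def V_def)
  then obtain a b where ab: "E = {a, b}" "a \<noteq> b" by (auto simp: card_2_iff)
  have "a \<noteq> 0" "b \<noteq> 0" using E(2) ab vec.dependent_zero by blast+
  obtain \<eta> where \<eta>: "scalar_product \<eta> a = 1" "scalar_product \<eta> b = 0"
    using exists_functional_separating[OF \<open>a \<noteq> 0\<close> ab(2)] by blast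
  obtain \<theta> where \<theta>: "scalar_product \<theta> b = 1" "scalar_product \<theta> a = 0"
    using exists_functional_separating[OF \<open>b \<noteq> 0\<close> ab(2)[symmetric]] by blast
  have V: "v = 0 \<or> v = a \<or> v = b \<or> v = a + b" if v: "v \<in> V" for v
  proof -
    have "v \<in> vec.span {a, b}" using E(3) v unfolding ab(1) by blast
    then obtain k where "v - k *s a \<in> vec.span {b}" using vec.span_breakdown_eq by blast
    then obtain l where "v - k *s a - l *s b \<in> vec.span {}" using vec.span_breakdown_eq by blast
    then have "v - k *s a - l *s b = 0" by (simp only: vec.span_empty singleton_iff)
    then have "v - k *s a = l *s b" by (simp only: right_minus_eq)
    then have "v = l *s b + k *s a" by (simp only: diff_eq_eq)
    then show ?thesis using bit_cases[of k] bit_cases[of l]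
      by (elim disjE) (simp_all only: vector_smult_lzero vector_smult_lid add_0 add_0_right add.commute simp_thms)
  qed
  have C: "\<eta> \<noteq> \<theta>" "\<eta> \<noteq> \<eta> + \<theta>" "\<theta> \<noteq> \<eta> + \<theta>" "\<eta> \<noteq> 0" "\<theta> \<noteq> 0" "\<eta> + \<theta> \<noteq> 0"
  proof -
    show "\<eta> \<noteq> \<theta>" using \<eta>(1) \<theta>(2) by (metis zero_neq_one)
    then show "\<eta> + \<theta> \<noteq> 0" by (simp add: bit_vec_add_eq_0_iff)
    show "\<eta> \<noteq> 0" "\<theta> \<noteq> 0"
      using \<eta>(1) \<theta>(1) by (metis scalar_product_zero_left zero_neq_one)+
    then show "\<eta> \<noteq> \<eta> + \<theta>" "\<theta> \<noteq> \<eta> + \<theta>"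
      by (metis add.right_neutral add_left_cancel, metis add_0 add_right_cancel)
  qed
  have "three_functionals B V {\<eta>, \<theta>, \<eta> + \<theta>}"
  proof (rule three_functionals.intro)
    have "(\<Union>i. B i) \<subseteq> V" unfolding V_def by (rule vec.span_superset)
    then show "B i \<subseteq> V" for i by blast
    show "0 \<in> V" by (simp add: V_def vec.span_zero)
    show "u + v \<in> V" if "u \<in> V" "v \<in> V" for u v
      using that by (simp add: V_def vec.span_add)
    show "card {\<eta>, \<theta>, \<eta> + \<theta>} = 3" using C by simp
    show "card {\<zeta> \<in> {\<eta>, \<theta>, \<eta> + \<theta>}. scalar_product \<zeta> v = 1} = 2" if v: "v \<in> V" "v \<noteq> 0" for v
    proof -
      have filter: "{\<zeta> \<in> {\<eta>, \<theta>, \<kappa>}. P \<zeta>} =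
          (if P \<eta> then {\<eta>} else {}) \<union> (if P \<theta> then {\<theta>} else {}) \<union> (if P \<kappa> then {\<kappa>} else {})" for P \<kappa>
        by auto
      have sum: "scalar_product (\<eta> + \<theta>) v = scalar_product \<eta> v + scalar_product \<theta> v"
        by (rule scalar_product_add_left)
      consider "v = a" | "v = b" | "v = a + b" using V[OF v(1)] v(2) by blast
      then have "scalar_product \<eta> v = 1 \<and> scalar_product \<theta> v = 0 \<or>
          scalar_product \<eta> v = 0 \<and> scalar_product \<theta> v = 1 \<or>
          scalar_product \<eta> v = 1 \<and> scalar_product \<theta> v = 1"
        by cases (use \<eta> \<theta> in \<open>simp_all add: scalar_product_add\<close>)
      then show ?thesis unfolding filter sum using C(1-3) by (elim disjE conjE) simp_all
    qed
  qed
  moreover have "0 \<notin> {\<eta>, \<theta>, \<eta> + \<theta>}" 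
    using C(4-6) by (simp only: insert_iff empty_iff eq_commute[of 0] simp_thms)
  ultimately show ?thesis by blast
qed

theorem theorem5p3:
  fixes B :: "'n::finite \<Rightarrow> (bit ^ 'd::finite) set"
  assumes "block_configuration B"
    and "block_rank B = 2"
  shows "CTP B = {x \<in> TP B. \<forall>\<eta> I. \<eta> \<noteq> 0 \<longrightarrow> odd (card I) \<longrightarrow> LOS_inequality B \<eta> I x}"
proof
  show "CTP B \<subseteq> {x \<in> TP B. \<forall>\<eta> I. \<eta> \<noteq> 0 \<longrightarrow> odd (card I) \<longrightarrow> LOS_inequality B \<eta> I x}"
    using CTP_subset_TP CTP_satisfies_LOS by blast
next
  obtain V C where "three_functionals B V C" and C: "0 \<notin> C"
    using exists_three_functionals[OF assms(2)] by blast
  then interpret three_functionals B V C by simp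
  have "{x \<in> TP B. \<forall>\<eta> I. \<eta> \<noteq> 0 \<longrightarrow> odd (card I) \<longrightarrow> LOS_inequality B \<eta> I x} \<subseteq> relaxation"
  proof
    fix x
    assume x: "x \<in> {x \<in> TP B. \<forall>\<eta> I. \<eta> \<noteq> 0 \<longrightarrow> odd (card I) \<longrightarrow> LOS_inequality B \<eta> I x}"
    then have st: "x \<in> stochastic B" using TP_subset_stochastic by blast
    have "1 \<le> (\<Sum>i\<in>UNIV. mismatch \<eta> I x i)" if "\<eta> \<in> C" "odd (card I)" for \<eta> I
    proof -
      have "\<eta> \<noteq> 0" using that(1) C by blast
      then have "LOS_inequality B \<eta> I x" using x that(2) by blast
      then show ?thesis by (simp add: LOS_inequality_iff[OF st])
    qed
    then show "x \<in> relaxation" using st by (simp add: relaxation_def)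
  qed
  then show "{x \<in> TP B. \<forall>\<eta> I. \<eta> \<noteq> 0 \<longrightarrow> odd (card I) \<longrightarrow> LOS_inequality B \<eta> I x} \<subseteq> CTP B"
    using relaxation_subset_CTP by blast
qed

end
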